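(* If $X$ is any regular space such that $\mathrm{pd}(X)<\mathrm{d}(X)$, then $\Delta(X)<2^{\mathrm{pd}(X)}$.
   Context: Regular spaces are assumed to be Hausdorff ($T_3$). For a topological space $X$ with topology $\tau_X$, a neighborhood assignment on $X$ is a map $U:X\to\tau_X$ with $x\in U(x)$ for all $x\in X$. A set $A\subseteq X$ pins down $U$ if $A\cap U(x)\neq\emptyset$ for all $x\in X$. The pinning down number $\mathrm{pd}(X)$ is the smallest cardinal $\kappa$ such that every neighborhood assignment on $X$ can be pinned down by a subset of $X$ of size $\kappa$. $\mathrm{d}(X)$ is the density of $X$ (the smallest cardinality of a dense subset). The dispersion character $\Delta(X)$ is the smallest cardinality of a non-empty open subset of $X$. *)

theory Defs
  imports "HOL-Analysis.Analysis"
begin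

unbundle cardinal_syntax

text \<open>
  A cardinal is represented, as in the library, by a cardinal order (a relation \<open>\<kappa>\<close> with
  \<open>Card_order \<kappa>\<close>), determined up to \<open>=o\<close>. All cardinals below are
  at most the cardinality of the space, so cardinal orders over the point type suffice.
\<close>

text \<open>
  The smallest member of a collection of cardinals. Being minimal only up to \<open>=o\<close>,
  it is picked by choice; if the collection is empty the value is unspecified.
\<close>

definition min_card :: "'a rel set \<Rightarrow> 'a rel" where
  "min_card R = (SOME r. r \<in> R \<and> (\<forall>r'\<in>R. r \<le>o r'))"

lemma min_card:
  assumes "R \<noteq> {}" and "\<And>r. r \<in> R \<Longrightarrow> Card_order r"
  shows "min_card R \<in> R" and "r' \<in> R \<Longrightarrow> min_card R \<le>o r'"
proof -
  have "\<exists>r. r \<in> R \<and> (\<forall>r'\<in>R. r \<le>o r')"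
    using exists_minim_Card_order[of R] assms by blast
  then have *: "min_card R \<in> R \<and> (\<forall>r'\<in>R. min_card R \<le>o r')"
    unfolding min_card_def by (rule someI_ex)
  show "min_card R \<in> R" using * by blast
  show "r' \<in> R \<Longrightarrow> min_card R \<le>o r'" using * by blast
qed

text \<open>Values of a neighborhood assignment outside \<open>topspace X\<close> are irrelevant.\<close>

definition neighborhood_assignment :: "'a topology \<Rightarrow> ('a \<Rightarrow> 'a set) \<Rightarrow> bool" where
  "neighborhood_assignment X U \<longleftrightarrow> (\<forall>x\<in>topspace X. openin X (U x) \<and> x \<in> U x)"

definition pins_down :: "'a topology \<Rightarrow> 'a set \<Rightarrow> ('a \<Rightarrow> 'a set) \<Rightarrow> bool" where
  "pins_down X A U \<longleftrightarrow> A \<subseteq> topspace X \<and> (\<forall>x\<in>topspace X. A \<inter> U x \<noteq> {})"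

definition pinning_down_number :: "'a topology \<Rightarrow> 'a rel" where
  "pinning_down_number X = min_card {\<kappa>. Card_order \<kappa> \<and>
     (\<forall>U. neighborhood_assignment X U \<longrightarrow> (\<exists>A. pins_down X A U \<and> |A| =o \<kappa>))}"

definition density_number :: "'a topology \<Rightarrow> 'a rel" where
  "density_number X = min_card {|D| | D. D \<subseteq> topspace X \<and> X closure_of D = topspace X}"

definition dispersion_character :: "'a topology \<Rightarrow> 'a rel" where
  "dispersion_character X = min_card {|G| | G. openin X G \<and> G \<noteq> {}}"

lemma pinning_down_number:
  fixes X :: "'a topology" and \<kappa> :: "'a rel"
  shows "Card_order (pinning_down_number X)"
    and "neighborhood_assignment X U \<Longrightarrow> \<exists>A. pins_down X A U \<and> |A| =o pinning_down_number X"
    and "Card_order \<kappa> \<Longrightarrow>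
      (\<And>U. neighborhood_assignment X U \<Longrightarrow> \<exists>A. pins_down X A U \<and> |A| =o \<kappa>)
      \<Longrightarrow> pinning_down_number X \<le>o \<kappa>"
proof -
  define R :: "'a rel set" where "R = {\<kappa>. Card_order \<kappa> \<and>
    (\<forall>U. neighborhood_assignment X U \<longrightarrow> (\<exists>A. pins_down X A U \<and> |A| =o \<kappa>))}"
  have eq: "pinning_down_number X = min_card R"
    by (simp only: pinning_down_number_def R_def)
  have "pins_down X (topspace X) U" if "neighborhood_assignment X U" for U
    using that unfolding neighborhood_assignment_def pins_down_def by auto
  then have "|topspace X| \<in> R"
    unfolding R_def mem_Collect_eq using card_of_Card_order card_of_refl by metis
  then have ne: "R \<noteq> {}" by auto
  have co: "Card_order r" if "r \<in> R" for r
    using that unfolding R_def mem_Collect_eq by (rule conjunct1)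
  have "pinning_down_number X \<in> R" unfolding eq by (rule min_card(1)[OF ne co])
  then have *: "Card_order (pinning_down_number X) \<and> (\<forall>U. neighborhood_assignment X U \<longrightarrow>
      (\<exists>A. pins_down X A U \<and> |A| =o pinning_down_number X))"
    unfolding R_def mem_Collect_eq .
  show "Card_order (pinning_down_number X)" using * by (rule conjunct1)
  show "neighborhood_assignment X U \<Longrightarrow> \<exists>A. pins_down X A U \<and> |A| =o pinning_down_number X"
    by (rule conjunct2[OF *, rule_format])
  show "pinning_down_number X \<le>o \<kappa>" if "Card_order \<kappa>"
    "\<And>U. neighborhood_assignment X U \<Longrightarrow> \<exists>A. pins_down X A U \<and> |A| =o \<kappa>"
  proof -
    have kR: "\<kappa> \<in> R" unfolding R_def mem_Collect_eq using that by (intro conjI allI impI)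
    show ?thesis unfolding eq by (rule min_card(2)[OF ne co kR])
  qed
qed

lemma density_number:
  shows "\<exists>D. density_number X = |D| \<and> D \<subseteq> topspace X \<and> X closure_of D = topspace X"
    and "D \<subseteq> topspace X \<Longrightarrow> X closure_of D = topspace X \<Longrightarrow> density_number X \<le>o |D|"
proof -
  define R :: "'a rel set" where "R = {|D| | D. D \<subseteq> topspace X \<and> X closure_of D = topspace X}"
  have eq: "density_number X = min_card R"
    by (simp only: density_number_def R_def)
  have in_R: "|D| \<in> R" if "D \<subseteq> topspace X" "X closure_of D = topspace X" for D
    unfolding R_def mem_Collect_eq using that by (intro exI conjI) (rule refl)
  have ne: "R \<noteq> {}" using in_R[of "topspace X"] closure_of_topspace[of X] by auto
  have co: "Card_order r" if "r \<in> R" for r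
    using that card_of_Card_order unfolding R_def mem_Collect_eq by metis
  have "density_number X \<in> R" unfolding eq by (rule min_card(1)[OF ne co])
  then show "\<exists>D. density_number X = |D| \<and> D \<subseteq> topspace X \<and> X closure_of D = topspace X"
    unfolding R_def mem_Collect_eq .
  show "density_number X \<le>o |D|" if "D \<subseteq> topspace X" "X closure_of D = topspace X"
    unfolding eq by (rule min_card(2)[OF ne co in_R[OF that]])
qed

lemma dispersion_character:
  assumes "topspace X \<noteq> {}"
  shows "\<exists>G. dispersion_character X = |G| \<and> openin X G \<and> G \<noteq> {}"
    and "openin X G \<Longrightarrow> G \<noteq> {} \<Longrightarrow> dispersion_character X \<le>o |G|"
proof -
  define R :: "'a rel set" where "R = {|G| | G. openin X G \<and> G \<noteq> {}}"
  have eq: "dispersion_character X = min_card R"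
    by (simp only: dispersion_character_def R_def)
  have in_R: "|G| \<in> R" if "openin X G" "G \<noteq> {}" for G
    unfolding R_def mem_Collect_eq using that by (intro exI conjI) (rule refl)
  have ne: "R \<noteq> {}" using in_R[of "topspace X"] assms openin_topspace[of X] by auto
  have co: "Card_order r" if "r \<in> R" for r
    using that card_of_Card_order unfolding R_def mem_Collect_eq by metis
  have "dispersion_character X \<in> R" unfolding eq by (rule min_card(1)[OF ne co])
  then show "\<exists>G. dispersion_character X = |G| \<and> openin X G \<and> G \<noteq> {}"
    unfolding R_def mem_Collect_eq .
  show "dispersion_character X \<le>o |G|" if "openin X G" "G \<noteq> {}"
    unfolding eq by (rule min_card(2)[OF ne co in_R[OF that]])
qed

end

theory Submission
  imports Defs
begin

text \<open>
  Let \<open>\<kappa> = pd(X)\<close> and suppose \<open>2^\<kappa> \<le> \<Delta>(X)\<close>. A family of open sets, each at least as large as the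
  family itself, has distinct representatives; they turn it into a neighborhood assignment, so
  some set of size at most \<open>\<kappa>\<close> meets every member. Hence every nonempty open \<open>W\<close> contains a
  nonempty open set lying in the closure of a set of size at most \<open>\<kappa>\<close>. If all nonempty open
  subsets of \<open>W\<close> are larger than \<open>2^\<kappa>\<close>, then \<open>W\<close> has at most \<open>2^\<kappa>\<close> regular open subsets, and
  by regularity a set meeting all of them is dense in \<open>W\<close>. Otherwise some nonempty open \<open>G \<subseteq> W\<close>
  has size \<open>2^\<kappa>\<close>, hence only \<open>2^\<kappa>\<close> subsets \<open>A\<close> of size at most \<open>\<kappa>\<close>, and a \<open>\<kappa>\<close>-sized set
  cannot meet all the complements \<open>G - cl A\<close>, so one of these is empty. A maximal disjoint family
  of such small-density open sets has at most \<open>\<kappa>\<close> members, whence \<open>d(X) \<le> \<kappa>\<close>.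
\<close>

section \<open>Distinct representatives and transversals\<close>

text \<open>In a well-order of \<open>\<G>\<close> of cardinal type, every member has strictly fewer
  predecessors than elements, so recursion can always pick an element not chosen before.\<close>

lemma exists_distinct_representatives:
  fixes \<G> :: "'a set set"
  assumes "\<And>G. G \<in> \<G> \<Longrightarrow> |\<G>| \<le>o |G|"
  obtains f where "inj_on f \<G>" and "\<And>G. G \<in> \<G> \<Longrightarrow> f G \<in> G"
proof -
  define r where "r = |\<G>|"
  have wo: "Well_order r" and co: "Card_order r" and Fr: "Field r = \<G>"
    unfolding r_def by (rule card_of_Well_order card_of_Card_order Field_card_of)+
  have wf: "wf (r - Id)" using wo unfolding well_order_on_def by blast
  define F where "F = (\<lambda>f G. SOME x. x \<in> G \<and> x \<notin> f ` underS r G)"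
  define f where "f = wfrec (r - Id) F"
  have f_unfold: "f G = (SOME x. x \<in> G \<and> x \<notin> f ` underS r G)" for G
  proof -
    have "f G = F (cut f (r - Id) G) G"
      unfolding f_def by (rule wfrec[OF wf])
    also have "cut f (r - Id) G ` underS r G = f ` underS r G"
      by (intro image_cong refl) (auto simp: cut_def underS_def)
    then have "F (cut f (r - Id) G) G = (SOME x. x \<in> G \<and> x \<notin> f ` underS r G)"
      unfolding F_def by simp
    finally show ?thesis .
  qed
  have step: "f G \<in> G \<and> f G \<notin> f ` underS r G" if G: "G \<in> \<G>" for G
  proof -
    have "|underS r G| <o r" using card_of_underS[OF co] G Fr by auto
    then have "|f ` underS r G| <o |G|"
      using assms[OF G] unfolding r_def
      by (meson card_of_image ordLeq_ordLess_trans ordLess_ordLeq_trans)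
    then have "\<not> G \<subseteq> f ` underS r G"
      using card_of_mono1 not_ordLess_ordLeq by blast
    then have "\<exists>x. x \<in> G \<and> x \<notin> f ` underS r G" by blast
    from someI_ex[OF this] show ?thesis unfolding f_unfold[of G, symmetric] .
  qed
  have "inj_on f \<G>"
  proof (rule inj_onI, rule ccontr)
    fix G H assume GH: "G \<in> \<G>" "H \<in> \<G>" "f G = f H" "G \<noteq> H"
    then have "G \<in> underS r H \<or> H \<in> underS r G"
      using wo Fr unfolding well_order_on_def linear_order_on_def total_on_def underS_def by auto
    then show False using step[OF GH(1)] step[OF GH(2)] GH(3) by (metis imageI)
  qed
  with step that show thesis by blast
qed

text \<open>Each representative is assigned the member it represents, which distinctness makes
  unambiguous; every other point gets the whole space. A set pinning down this assignment meets
  every member.\<close>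

lemma exists_transversal:
  fixes X :: "'a topology" and K :: "'b set"
  assumes pin: "\<And>U. neighborhood_assignment X U \<Longrightarrow> \<exists>A. pins_down X A U \<and> |A| \<le>o |K|"
    and op: "\<And>G. G \<in> \<G> \<Longrightarrow> openin X G"
    and card: "\<And>G. G \<in> \<G> \<Longrightarrow> |\<G>| \<le>o |G|"
  obtains A where "A \<subseteq> topspace X" "|A| \<le>o |K|" "\<And>G. G \<in> \<G> \<Longrightarrow> A \<inter> G \<noteq> {}"
proof -
  obtain f where inj: "inj_on f \<G>" and f: "\<And>G. G \<in> \<G> \<Longrightarrow> f G \<in> G"
    using exists_distinct_representatives[OF card] by metis
  define U where "U = (\<lambda>x. if x \<in> f ` \<G> then inv_into \<G> f x else topspace X)"
  have Uf: "U (f G) = G" if "G \<in> \<G>" for G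
    using that inj unfolding U_def by auto
  have "neighborhood_assignment X U"
    unfolding neighborhood_assignment_def
  proof
    fix x assume "x \<in> topspace X"
    then show "openin X (U x) \<and> x \<in> U x"
      using Uf f op by (cases "x \<in> f ` \<G>") (auto simp: U_def)
  qed
  then obtain A where A: "pins_down X A U" "|A| \<le>o |K|" using pin by blast
  have "A \<inter> G \<noteq> {}" if "G \<in> \<G>" for G
  proof -
    have "f G \<in> topspace X" using f[OF that] op[OF that] openin_subset by blast
    then show ?thesis using A(1) Uf[OF that] unfolding pins_down_def by metis
  qed
  then show thesis using that A unfolding pins_down_def by blast
qed

section \<open>Regular open sets where all open sets are large\<close>

lemma regular_open_subset_of_closure:
  assumes "openin X U" "X interior_of (X closure_of V) = V" "U \<subseteq> X closure_of V"
  shows "U \<subseteq> V"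
  using interior_of_maximal[OF assms(3,1)] assms(2) by simp

text \<open>
  Given more than \<open>2^\<kappa>\<close> regular open sets, let \<open>A\<close> of size \<open>\<kappa>\<close> meet all nonempty differences
  \<open>U - cl V\<close> of \<open>(2^\<kappa>)\<^sup>+\<close> of them. Two of these sets have the same trace on \<open>A\<close>, so \<open>A\<close>
  misses both of their differences, which forces them to coincide.
\<close>

lemma card_regular_open_le:
  fixes X :: "'a topology" and K :: "'b set"
  assumes pin: "\<And>U. neighborhood_assignment X U \<Longrightarrow> \<exists>A. pins_down X A U \<and> |A| \<le>o |K|"
    and inf: "infinite K"
    and large: "\<And>G. openin X G \<Longrightarrow> G \<noteq> {} \<Longrightarrow> G \<subseteq> W \<Longrightarrow> |Pow K| <o |G|"
  shows "|{R. openin X R \<and> R \<subseteq> W \<and> X interior_of (X closure_of R) = R}| \<le>o |Pow K|"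
    (is "|?RO| \<le>o _")
proof (rule ccontr)
  assume "\<not> ?thesis"
  then have "|Pow K| <o |?RO|"
    using not_ordLeq_iff_ordLess[OF card_of_Well_order card_of_Well_order] by blast
  then have suc: "cardSuc |Pow K| \<le>o |?RO|"
    using cardSuc_ordLess_ordLeq[OF card_of_Card_order card_of_Card_order] by blast
  have cs: "cardSuc |Pow K| =o |Field (cardSuc |Pow K| )|"
    by (rule ordIso_symmetric[OF card_of_Field_ordIso[OF cardSuc_Card_order[OF card_of_Card_order]]])
  have "|Field (cardSuc |Pow K| )| \<le>o |?RO|"
    by (rule ordIso_ordLeq_trans[OF ordIso_symmetric[OF cs] suc])
  then obtain h where h: "inj_on h (Field (cardSuc |Pow K| ))" "h ` Field (cardSuc |Pow K| ) \<subseteq> ?RO"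
    unfolding card_of_ordLeq[symmetric] by blast
  \<comment> \<open>Keeping exactly (2^|K|)^+ regular open sets is enough for the contradiction, yet
    leaves no more differences than each nonempty open subset of \<open>W\<close> has points, as
    \<open>exists_transversal\<close> requires.\<close>
  define \<U> where "\<U> = h ` Field (cardSuc |Pow K| )"
  have sub: "\<U> \<subseteq> ?RO" using h(2) \<U>_def by simp
  have "|Field (cardSuc |Pow K| )| =o |\<U>|"
    using h(1) unfolding \<U>_def by (metis card_of_ordIso bij_betw_imageI)
  then have \<U>: "|\<U>| =o cardSuc |Pow K|"
    by (rule ordIso_symmetric[OF ordIso_transitive[OF cs]])
  then have less: "|Pow K| <o |\<U>|"
    using ordLess_ordIso_trans[OF cardSuc_greater[OF card_of_Card_order]] ordIso_symmetric by blast
  then have inf\<U>: "infinite \<U>"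
    using inf by (meson card_of_ordLeq_infinite finite_Pow_iff ordLess_imp_ordLeq)
  define \<G> where "\<G> = (\<lambda>(U, V). U - X closure_of V) ` (\<U> \<times> \<U>) - {{}}"
  have "|\<G>| \<le>o |(\<lambda>(U, V). U - X closure_of V) ` (\<U> \<times> \<U>)|"
    unfolding \<G>_def by (rule card_of_mono1) blast
  then have "|\<G>| \<le>o |\<U> \<times> \<U>|" using card_of_image ordLeq_transitive by blast
  then have \<G>\<U>: "|\<G>| \<le>o |\<U>|"
    using card_of_Times_same_infinite[OF inf\<U>] ordLeq_ordIso_trans by blast
  have op: "openin X G \<and> G \<noteq> {} \<and> G \<subseteq> W" if "G \<in> \<G>" for G
    using that sub unfolding \<G>_def by (auto intro!: openin_diff)
  have card: "|\<G>| \<le>o |G|" if "G \<in> \<G>" for G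
  proof -
    have "|Pow K| <o |G|" using large op[OF that] by blast
    then have "cardSuc |Pow K| \<le>o |G|"
      using cardSuc_ordLess_ordLeq[OF card_of_Card_order card_of_Card_order] by blast
    then show ?thesis by (rule ordLeq_transitive[OF \<G>\<U> ordIso_ordLeq_trans[OF \<U>]])
  qed
  obtain A where A: "|A| \<le>o |K|" and meets: "\<And>G. G \<in> \<G> \<Longrightarrow> A \<inter> G \<noteq> {}"
    using exists_transversal[OF pin, of \<G>] op card by metis
  have subset: "U \<subseteq> V" if "U \<in> \<U>" "V \<in> \<U>" "U \<inter> A = V \<inter> A" for U V
  proof -
    have ro: "openin X U" "openin X V" "X interior_of (X closure_of V) = V"
      using that sub by auto
    have "V \<subseteq> X closure_of V" using ro(2) by (simp add: closure_of_subset openin_subset)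
    then have "A \<inter> (U - X closure_of V) = {}" using that(3) by blast
    then have "U - X closure_of V \<notin> \<G>" using meets by blast
    then have "U \<subseteq> X closure_of V" using that unfolding \<G>_def by auto
    then show ?thesis using regular_open_subset_of_closure ro by blast
  qed
  have "inj_on (\<lambda>U. U \<inter> A) \<U>"
    by (rule inj_onI) (metis subset subset_antisym)
  then have "|\<U>| \<le>o |Pow A|" using card_of_ordLeq[of \<U> "Pow A"] by blast
  also have "|Pow A| \<le>o |Pow K|"
  proof -
    obtain g where g: "inj_on g A" "g ` A \<subseteq> K"
      using A unfolding card_of_ordLeq[symmetric] by blast
    have "inj_on (image g) (Pow A)" "image g ` Pow A \<subseteq> Pow K"
      using inj_on_image_Pow[OF g(1)] g(2) by auto
    then show ?thesis unfolding card_of_ordLeq[symmetric] by blast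
  qed
  finally show False using less not_ordLess_ordLeq by blast
qed

text \<open>The nonempty regular open subsets of \<open>W\<close> number at most 2^|K| and each has
  more points than that, so one small set meets them all. Regularity finds one of them inside
  \<open>W\<close> and any given open neighbourhood of a point of \<open>W\<close>.\<close>

lemma small_dense_if_all_open_large:
  fixes X :: "'a topology" and K :: "'b set"
  assumes pin: "\<And>U. neighborhood_assignment X U \<Longrightarrow> \<exists>A. pins_down X A U \<and> |A| \<le>o |K|"
    and reg: "regular_space X" and inf: "infinite K" and W: "openin X W"
    and large: "\<And>G. openin X G \<Longrightarrow> G \<noteq> {} \<Longrightarrow> G \<subseteq> W \<Longrightarrow> |Pow K| <o |G|"
  shows "\<exists>A\<subseteq>topspace X. |A| \<le>o |K| \<and> W \<subseteq> X closure_of A"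
proof -
  define \<G> where "\<G> = {R. openin X R \<and> R \<subseteq> W \<and> X interior_of (X closure_of R) = R} - {{}}"
  have "|\<G>| \<le>o |Pow K|"
    unfolding \<G>_def
    by (rule ordLeq_transitive[OF card_of_mono1[OF Diff_subset] card_regular_open_le[OF pin inf large]])
  then have card: "|\<G>| \<le>o |G|" if "G \<in> \<G>" for G
  proof -
    have "|Pow K| <o |G|" using large that unfolding \<G>_def by blast
    with \<open>|\<G>| \<le>o |Pow K|\<close> show ?thesis
      by (rule ordLess_imp_ordLeq[OF ordLeq_ordLess_trans])
  qed
  have op: "openin X G" if "G \<in> \<G>" for G using that unfolding \<G>_def by blast
  obtain A where A: "A \<subseteq> topspace X" "|A| \<le>o |K|" and meets: "\<And>G. G \<in> \<G> \<Longrightarrow> A \<inter> G \<noteq> {}"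
    using exists_transversal[OF pin, of \<G>] op card by metis
  have "W \<subseteq> X closure_of A"
  proof
    fix x assume x: "x \<in> W"
    have "\<exists>y\<in>A. y \<in> T" if T: "x \<in> T" "openin X T" for T
    proof -
      have "neighbourhood_base_of (closedin X) X"
        using reg by (simp only: neighbourhood_base_of_closedin)
      then have "\<exists>V C. openin X V \<and> closedin X C \<and> x \<in> V \<and> V \<subseteq> C \<and> C \<subseteq> T \<inter> W"
        using x T(1) openin_Int[OF T(2) W] unfolding neighbourhood_base_of by blast
      then obtain V C where V: "openin X V" "closedin X C" "x \<in> V" "V \<subseteq> C" "C \<subseteq> T \<inter> W"
        by blast
      \<comment> \<open>This set is regular open and contains \<open>V\<close>; it stays inside
        \<open>T \<inter> W\<close> because the closed set \<open>C\<close> traps the closure of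
        \<open>V\<close>.\<close>
      define R where "R = X interior_of (X closure_of V)"
      have "X closure_of V \<subseteq> C" using V by (simp add: closure_of_minimal)
      then have RT: "R \<subseteq> T \<inter> W" using V(5) interior_of_subset[of X "X closure_of V"]
        unfolding R_def by blast
      have "V \<subseteq> R" unfolding R_def
        using V(1) by (simp add: closure_of_subset interior_of_maximal openin_subset)
      have "X closure_of R \<subseteq> X closure_of V"
        unfolding R_def by (simp add: closure_of_minimal interior_of_subset)
      then have "X interior_of (X closure_of R) \<subseteq> R"
        by (subst (2) R_def) (rule interior_of_mono)
      moreover have opR: "openin X R" unfolding R_def by simp
      then have "R \<subseteq> X interior_of (X closure_of R)"
        by (simp add: closure_of_subset interior_of_maximal openin_subset)
      ultimately have "R \<in> \<G>" using RT V(3) \<open>V \<subseteq> R\<close> opR unfolding \<G>_def by blast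
      then show ?thesis using meets RT by blast
    qed
    then show "x \<in> X closure_of A"
      using x openin_subset[OF W] unfolding in_closure_of by blast
  qed
  then show ?thesis using A by blast
qed

section \<open>Open sets of size at most 2^|K|\<close>

text \<open>(2^|K|)^|K| = 2^(|K| * |K|) = 2^|K|. This bounds the number of small subsets of a set of
  size at most 2^|K|.\<close>

lemma card_of_Func_Pow:
  assumes "infinite K"
  shows "|Func K (Pow K)| =o |Pow K|"
proof -
  have pow: "|Pow K| =o ctwo ^c |K|"
    unfolding cexp_def ctwo_def Field_card_of by (rule card_of_Pow_Func)
  have K: "Cinfinite |K|"
    unfolding cinfinite_def using assms card_of_Card_order by (metis Field_card_of)
  have "|Func K (Pow K)| =o |Pow K| ^c |K|"
    unfolding cexp_def Field_card_of by (rule card_of_refl)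
  also have "|Pow K| ^c |K| =o (ctwo ^c |K| ) ^c |K|"
    using pow card_of_Card_order by (rule cexp_cong1)
  also have "(ctwo ^c |K| ) ^c |K| =o ctwo ^c |K|"
    using K by (intro cexp_cprod_ordLeq Card_order_ctwo Cinfinite_Cnotzero)
      (simp_all add: card_of_mono1)
  also have "ctwo ^c |K| =o |Pow K|" using pow by (rule ordIso_symmetric)
  finally show ?thesis .
qed

text \<open>A diagonal argument: a small \<open>B\<close> meeting \<open>W - X closure_of A\<close>
  for every small nonempty \<open>A \<subseteq> W\<close> would have to do so for
  \<open>A = B \<inter> W\<close>, which lies in its own closure.\<close>

lemma small_dense_if_small_open:
  fixes X :: "'a topology" and K :: "'b set"
  assumes pin: "\<And>U. neighborhood_assignment X U \<Longrightarrow> \<exists>A. pins_down X A U \<and> |A| \<le>o |K|"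
    and inf: "infinite K" and W: "openin X W" "|W| \<le>o |Pow K|"
    and large: "\<And>G. openin X G \<Longrightarrow> G \<noteq> {} \<Longrightarrow> G \<subseteq> W \<Longrightarrow> |Pow K| \<le>o |G|"
  shows "\<exists>A\<subseteq>topspace X. |A| \<le>o |K| \<and> W \<subseteq> X closure_of A"
proof (cases "W = {}")
  case True then show ?thesis using card_of_empty by auto
next
  case ne: False
  have Wtop: "W \<subseteq> topspace X" using W(1) openin_subset by blast
  show ?thesis
  proof (rule ccontr)
    assume small: "\<not> ?thesis"
    have not_dense: "\<not> W \<subseteq> X closure_of A" if "A \<subseteq> W" "|A| \<le>o |K|" for A
      using small that Wtop by (meson subset_trans)
    \<comment> \<open>Small nonempty subsets of \<open>W\<close> are represented as ranges of
      functions from \<open>K\<close>, so that counting functions bounds the family.\<close>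
    define \<G> where "\<G> = (\<lambda>f. W - X closure_of (f ` K)) ` Func K W"
    have "|Func K W| \<le>o |Func K (Pow K)|"
      using cexp_mono1[OF W(2) card_of_Card_order, of K] unfolding cexp_def Field_card_of .
    also have "|Func K (Pow K)| \<le>o |Pow K|"
      using card_of_Func_Pow[OF inf] by (rule ordIso_imp_ordLeq)
    finally have \<G>: "|\<G>| \<le>o |Pow K|"
      unfolding \<G>_def by (rule ordLeq_transitive[OF card_of_image])
    have op: "openin X G \<and> G \<noteq> {} \<and> G \<subseteq> W" if G: "G \<in> \<G>" for G
    proof -
      obtain f where f: "f \<in> Func K W" "G = W - X closure_of (f ` K)"
        using G \<G>_def by auto
      have "f ` K \<subseteq> W" using f(1) unfolding Func_def by auto
      then have "\<not> W \<subseteq> X closure_of (f ` K)" using card_of_image by (rule not_dense)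
      then show ?thesis using f(2) W(1) by (auto intro: openin_diff)
    qed
    have card: "|\<G>| \<le>o |G|" if "G \<in> \<G>" for G
      using \<G> by (rule ordLeq_transitive[OF _ large]) (use op[OF that] in blast)+
    obtain B where B: "|B| \<le>o |K|" and meets: "\<And>G. G \<in> \<G> \<Longrightarrow> B \<inter> G \<noteq> {}"
      using exists_transversal[OF pin, of \<G>] op card by metis
    have meets_W: "\<exists>b\<in>B. b \<in> W - X closure_of (f ` K)" if "f \<in> Func K W" for f
      using meets that unfolding \<G>_def by blast
    \<comment> \<open>Only a nonempty set is a range of a function on \<open>K\<close>; the
      complement coming from a constant function forces \<open>B\<close> to meet
      \<open>W\<close>.\<close>
    obtain w where "w \<in> W" using ne by blast
    then have "(\<lambda>k. if k \<in> K then w else undefined) \<in> Func K W" unfolding Func_def by auto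
    then have "B \<inter> W \<noteq> {}" using meets_W by blast
    moreover have "|B \<inter> W| \<le>o |K|"
      by (rule ordLeq_transitive[OF card_of_mono1 B]) blast
    ultimately obtain g where g: "g ` K = B \<inter> W"
      unfolding card_of_ordLeq2[OF \<open>B \<inter> W \<noteq> {}\<close>, symmetric] by blast
    define f where "f = (\<lambda>k. if k \<in> K then g k else undefined)"
    have f: "f \<in> Func K W" "f ` K = B \<inter> W" using g unfolding f_def Func_def by auto
    have "B \<inter> W \<subseteq> X closure_of (B \<inter> W)" using Wtop by (intro closure_of_subset) blast
    then show False using meets_W[OF f(1)] f(2) by auto
  qed
qed

section \<open>Infinitude of \<open>K\<close>\<close>

text \<open>If \<open>K\<close> had n elements, n + 1 points with pairwise disjoint neighbourhoods
  would need n + 1 pinning points.\<close>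

lemma infinite_if_pinned_and_larger:
  fixes X :: "'a topology" and K :: "'b set"
  assumes haus: "Hausdorff_space X"
    and pin: "\<And>U. neighborhood_assignment X U \<Longrightarrow> \<exists>A. pins_down X A U \<and> |A| \<le>o |K|"
    and less: "|K| <o |topspace X|"
  shows "infinite K"
proof
  assume fin: "finite K"
  have "\<exists>F. F \<subseteq> topspace X \<and> finite F \<and> card F = Suc (card K)"
  proof (cases "finite (topspace X)")
    case True
    have "\<not> |topspace X| \<le>o |K|" using less not_ordLess_ordLeq by blast
    then have "\<not> card (topspace X) \<le> card K"
      using card_le_inj[OF True fin] card_of_ordLeq by blast
    then have "Suc (card K) \<le> card (topspace X)" by simp
    then show ?thesis using obtain_subset_with_card_n by metis
  next
    case False
    then show ?thesis using infinite_arbitrarily_large by metis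
  qed
  then obtain F where F: "F \<subseteq> topspace X" "finite F" "card F = Suc (card K)" by blast
  have "\<forall>x y. \<exists>P Q. x \<in> F \<and> y \<in> F \<and> x \<noteq> y \<longrightarrow>
      openin X P \<and> openin X Q \<and> x \<in> P \<and> y \<in> Q \<and> disjnt P Q"
    using haus F(1) unfolding Hausdorff_space_def by (meson subsetD)
  then obtain P Q where PQ: "\<And>x y. x \<in> F \<Longrightarrow> y \<in> F \<Longrightarrow> x \<noteq> y \<Longrightarrow>
      openin X (P x y) \<and> openin X (Q x y) \<and> x \<in> P x y \<and> y \<in> Q x y \<and> disjnt (P x y) (Q x y)"
    by metis
  \<comment> \<open>Both separations of each ordered pair are used: for distinct x, y in
    \<open>F\<close>, the set \<open>U x\<close> lies in \<open>P x y\<close> and \<open>U y\<close>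
    in the disjoint \<open>Q x y\<close>. Intersecting with \<open>topspace X\<close> covers a
    singleton \<open>F\<close>, where the intersection over the empty family is everything.\<close>
  define U where "U = (\<lambda>x. if x \<in> F
    then topspace X \<inter> \<Inter> ((\<lambda>y. P x y \<inter> Q y x) ` (F - {x})) else topspace X)"
  have "neighborhood_assignment X U"
    unfolding neighborhood_assignment_def
  proof (intro ballI conjI)
    fix x assume x: "x \<in> topspace X"
    show "x \<in> U x" using x PQ unfolding U_def by auto
    show "openin X (U x)"
    proof (cases "x \<in> F \<and> F - {x} \<noteq> {}")
      case True
      then have "openin X (\<Inter> ((\<lambda>y. P x y \<inter> Q y x) ` (F - {x})))"
        using F(2) PQ by (intro openin_Inter) (auto intro!: openin_Int)
      then show ?thesis using True unfolding U_def by auto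
    next
      case False
      then have "U x = topspace X" unfolding U_def by auto
      then show ?thesis by simp
    qed
  qed
  then obtain A where A: "pins_down X A U" "|A| \<le>o |K|" using pin by blast
  have "\<forall>x\<in>F. \<exists>a. a \<in> A \<inter> U x"
    using A(1) F(1) unfolding pins_down_def by blast
  then obtain a where a: "\<And>x. x \<in> F \<Longrightarrow> a x \<in> A \<inter> U x" by metis
  have "inj_on a F"
  proof (rule inj_onI, rule ccontr)
    fix x y assume xy: "x \<in> F" "y \<in> F" "a x = a y" "x \<noteq> y"
    have "a x \<in> P x y" using a[OF xy(1)] xy unfolding U_def by auto
    moreover have "a y \<in> Q x y" using a[OF xy(2)] xy unfolding U_def by auto
    ultimately show False using PQ[OF xy(1,2,4)] xy(3) unfolding disjnt_def by auto
  qed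
  then have "|F| \<le>o |A|" using a card_of_ordLeq by blast
  then have "|F| \<le>o |K|" using A(2) ordLeq_transitive by blast
  then have "card F \<le> card K" using card_of_ordLeq card_inj_on_le[OF _ _ fin] by metis
  then show False using F(3) by simp
qed

section \<open>From local to global density\<close>

text \<open>Each point of the union is assigned the unique member containing it; a pinning set then
  has a point in every member, and disjointness makes these points distinct.\<close>

lemma card_disjoint_open_le:
  fixes X :: "'a topology" and K :: "'b set"
  assumes pin: "\<And>U. neighborhood_assignment X U \<Longrightarrow> \<exists>A. pins_down X A U \<and> |A| \<le>o |K|"
    and op: "\<And>V. V \<in> \<V> \<Longrightarrow> openin X V \<and> V \<noteq> {}" and disj: "disjoint \<V>"
  shows "|\<V>| \<le>o |K|"
proof -
  define U where "U = (\<lambda>x. if x \<in> \<Union>\<V> then (THE V. V \<in> \<V> \<and> x \<in> V) else topspace X)"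
  have UV: "U x = V" if "x \<in> V" "V \<in> \<V>" for x V
  proof -
    have "(THE V. V \<in> \<V> \<and> x \<in> V) = V"
      using that disj by (intro the_equality) (auto simp: disjoint_def)
    then show ?thesis using that unfolding U_def by auto
  qed
  have "neighborhood_assignment X U"
    unfolding neighborhood_assignment_def
  proof
    fix x assume "x \<in> topspace X"
    then show "openin X (U x) \<and> x \<in> U x"
      using UV op by (cases "x \<in> \<Union>\<V>") (force, simp add: U_def)
  qed
  then obtain A where A: "pins_down X A U" "|A| \<le>o |K|" using pin by blast
  have "A \<inter> V \<noteq> {}" if "V \<in> \<V>" for V
  proof -
    obtain x where x: "x \<in> V" using op[OF \<open>V \<in> \<V>\<close>] by blast
    then have "x \<in> topspace X" using op[OF \<open>V \<in> \<V>\<close>] openin_subset by blast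
    then show ?thesis using A(1) UV[OF x \<open>V \<in> \<V>\<close>] unfolding pins_down_def by metis
  qed
  then have "\<forall>V\<in>\<V>. \<exists>x. x \<in> A \<inter> V" by blast
  then obtain a where a: "\<And>V. V \<in> \<V> \<Longrightarrow> a V \<in> A \<inter> V" by metis
  have "inj_on a \<V>" by (rule inj_onI) (metis IntD2 UV a)
  then have "|\<V>| \<le>o |A|" using a card_of_ordLeq by blast
  then show ?thesis using A(2) ordLeq_transitive by blast
qed

text \<open>A maximal disjoint family of open sets of this local kind has at most |K| members, so
  the union of the associated small sets is still small. An open set missing its closure would
  contain a further member.\<close>

lemma small_dense_if_locally:
  fixes X :: "'a topology" and K :: "'b set"
  assumes pin: "\<And>U. neighborhood_assignment X U \<Longrightarrow> \<exists>A. pins_down X A U \<and> |A| \<le>o |K|"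
    and inf: "infinite K"
    and loc: "\<And>W. openin X W \<Longrightarrow> W \<noteq> {} \<Longrightarrow> \<exists>V A. openin X V \<and> V \<noteq> {} \<and> V \<subseteq> W \<and>
      A \<subseteq> topspace X \<and> |A| \<le>o |K| \<and> V \<subseteq> X closure_of A"
  obtains D where "D \<subseteq> topspace X" "|D| \<le>o |K|" "X closure_of D = topspace X"
proof -
  define \<S> where "\<S> = {V. openin X V \<and> V \<noteq> {} \<and>
    (\<exists>A\<subseteq>topspace X. |A| \<le>o |K| \<and> V \<subseteq> X closure_of A)}"
  have "\<exists>M\<in>{\<V>. \<V> \<subseteq> \<S> \<and> disjoint \<V>}. \<forall>\<V>\<in>{\<V>. \<V> \<subseteq> \<S> \<and> disjoint \<V>}. M \<subseteq> \<V> \<longrightarrow> \<V> = M"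
  proof (rule subset_Zorn_nonempty)
    show "{\<V>. \<V> \<subseteq> \<S> \<and> disjoint \<V>} \<noteq> {}" by (auto intro!: exI[of _ "{}"])
    fix \<C> assume "\<C> \<noteq> {}" and chain: "subset.chain {\<V>. \<V> \<subseteq> \<S> \<and> disjoint \<V>} \<C>"
    have \<C>: "\<V> \<subseteq> \<S>" "disjoint \<V>" if "\<V> \<in> \<C>" for \<V>
      using chain that unfolding subset_chain_def by blast+
    have "disjoint (\<Union>\<C>)"
    proof (rule disjointI)
      fix a b assume ab: "a \<in> \<Union>\<C>" "b \<in> \<Union>\<C>" "a \<noteq> b"
      then obtain \<V>1 \<V>2 where \<V>: "\<V>1 \<in> \<C>" "a \<in> \<V>1" "\<V>2 \<in> \<C>" "b \<in> \<V>2" by blast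
      then have "\<V>1 \<subseteq> \<V>2 \<or> \<V>2 \<subseteq> \<V>1"
        using chain unfolding subset_chain_def by blast
      then obtain \<V> where "\<V> \<in> \<C>" "a \<in> \<V>" "b \<in> \<V>" using \<V> by blast
      then show "a \<inter> b = {}" using disjointD[OF \<C>(2)] ab(3) by blast
    qed
    moreover have "\<Union>\<C> \<subseteq> \<S>" using \<C>(1) by blast
    ultimately show "\<Union>\<C> \<in> {\<V>. \<V> \<subseteq> \<S> \<and> disjoint \<V>}" by simp
  qed
  then obtain \<V> where \<V>: "\<V> \<subseteq> \<S>" "disjoint \<V>"
    and max: "\<And>\<V>'. \<V>' \<subseteq> \<S> \<Longrightarrow> disjoint \<V>' \<Longrightarrow> \<V> \<subseteq> \<V>' \<Longrightarrow> \<V>' = \<V>" by auto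
  have card\<V>: "|\<V>| \<le>o |K|"
    using \<V>(1) by (intro card_disjoint_open_le[OF pin _ \<V>(2)]) (auto simp: \<S>_def)
  obtain E where E: "\<And>V. V \<in> \<V> \<Longrightarrow> E V \<subseteq> topspace X \<and> |E V| \<le>o |K| \<and> V \<subseteq> X closure_of (E V)"
  proof -
    have "\<forall>V\<in>\<V>. \<exists>A. A \<subseteq> topspace X \<and> |A| \<le>o |K| \<and> V \<subseteq> X closure_of A"
      using \<V>(1) unfolding \<S>_def by blast
    then show thesis using that by metis
  qed
  define D where "D = (\<Union>V\<in>\<V>. E V)"
  have Dtop: "D \<subseteq> topspace X" using E unfolding D_def by blast
  have "|D| \<le>o |K|"
    unfolding D_def using E by (intro card_of_UNION_ordLeq_infinite[OF inf card\<V>]) blast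
  moreover have "X closure_of D = topspace X"
  proof (rule ccontr)
    assume "X closure_of D \<noteq> topspace X"
    then have "topspace X - X closure_of D \<noteq> {}"
      using closure_of_subset_topspace[of X D] by blast
    moreover have "openin X (topspace X - X closure_of D)" by (simp add: openin_diff)
    ultimately obtain W where W: "W \<in> \<S>" "W \<subseteq> topspace X - X closure_of D"
      using loc unfolding \<S>_def mem_Collect_eq by metis
    have disj: "W \<inter> V = {}" if "V \<in> \<V>" for V
    proof -
      have "X closure_of (E V) \<subseteq> X closure_of D"
        using that unfolding D_def by (intro closure_of_mono) blast
      then show ?thesis using E[OF that] W(2) by blast
    qed
    have "disjoint (insert W \<V>)"
      using \<V>(2) disj by (auto simp: disjoint_def)
    then have "W \<in> \<V>" using max[of "insert W \<V>"] W(1) \<V>(1) by blast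
    \<comment> \<open>Applied to \<open>W\<close> itself, \<open>disj\<close> makes \<open>W\<close>
      empty.\<close>
    then show False using disj W(1) unfolding \<S>_def by blast
  qed
  ultimately show thesis using that Dtop by blast
qed

theorem theorem4p9:
  fixes X :: "'a topology"
  assumes "regular_space X" and "Hausdorff_space X"
    and "pinning_down_number X <o density_number X"
  shows "dispersion_character X <o ctwo ^c pinning_down_number X"
proof (rule ccontr)
  assume neg: "\<not> ?thesis"
  define K where "K = Field (pinning_down_number X)"
  have K: "|K| =o pinning_down_number X"
    unfolding K_def by (rule card_of_Field_ordIso[OF pinning_down_number(1)])
  have pin: "\<exists>A. pins_down X A U \<and> |A| \<le>o |K|" if "neighborhood_assignment X U" for U
  proof -
    obtain A where A: "pins_down X A U" "|A| =o pinning_down_number X"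
      using pinning_down_number(2)[OF \<open>neighborhood_assignment X U\<close>] by blast
    have "|A| \<le>o |K|"
      by (rule ordIso_imp_ordLeq[OF ordIso_transitive[OF A(2) ordIso_symmetric[OF K]]])
    with A(1) show ?thesis by blast
  qed
  have less: "|K| <o density_number X"
    using K assms(3) by (rule ordIso_ordLess_trans)
  have "density_number X \<le>o |topspace X|"
    by (rule density_number(2)) auto
  with less have less_top: "|K| <o |topspace X|" by (rule ordLess_ordLeq_trans)
  have inf: "infinite K" by (rule infinite_if_pinned_and_larger[OF assms(2) pin less_top])
  \<comment> \<open>Without a nonempty open set the dispersion character would be an unspecified
    value.\<close>
  have ne: "topspace X \<noteq> {}"
    using less_top by (metis card_of_empty not_ordLess_ordLeq)
  have pow: "|Pow K| =o ctwo ^c pinning_down_number X"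
    unfolding cexp_def ctwo_def Field_card_of K_def[symmetric] by (rule card_of_Pow_Func)
  have "Well_order (dispersion_character X)"
    using dispersion_character(1)[OF ne] card_of_Well_order by metis
  then have le: "ctwo ^c pinning_down_number X \<le>o dispersion_character X"
    using neg unfolding cexp_def by (simp only: not_ordLess_iff_ordLeq card_of_Well_order)
  have large: "|Pow K| \<le>o |G|" if "openin X G" "G \<noteq> {}" for G
    by (rule ordLeq_transitive[OF ordIso_ordLeq_trans[OF pow le] dispersion_character(2)[OF ne that]])
  have loc: "\<exists>V A. openin X V \<and> V \<noteq> {} \<and> V \<subseteq> W \<and>
      A \<subseteq> topspace X \<and> |A| \<le>o |K| \<and> V \<subseteq> X closure_of A" if W: "openin X W" "W \<noteq> {}" for W
  proof (cases "\<forall>G. openin X G \<and> G \<noteq> {} \<and> G \<subseteq> W \<longrightarrow> |Pow K| <o |G|")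
    case True
    then have "\<exists>A\<subseteq>topspace X. |A| \<le>o |K| \<and> W \<subseteq> X closure_of A"
      by (intro small_dense_if_all_open_large[OF pin assms(1) inf W(1)]) blast+
    then show ?thesis using W by blast
  next
    case False
    \<comment> \<open>By \<open>large\<close>, this \<open>G\<close> has size exactly 2^|K|, and so
      has every nonempty open subset of it.\<close>
    then obtain G where G: "openin X G" "G \<noteq> {}" "G \<subseteq> W" "|G| \<le>o |Pow K|"
      using not_ordLess_iff_ordLeq[OF card_of_Well_order card_of_Well_order] by blast
    have "\<exists>A\<subseteq>topspace X. |A| \<le>o |K| \<and> G \<subseteq> X closure_of A"
      using pin inf G(1,4) large by (rule small_dense_if_small_open)
    then show ?thesis using G by blast
  qed
  obtain D where D: "D \<subseteq> topspace X" "|D| \<le>o |K|" "X closure_of D = topspace X"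
    using small_dense_if_locally[OF pin inf loc] by metis
  have "density_number X \<le>o |K|"
    using density_number(2)[OF D(1,3)] D(2) by (rule ordLeq_transitive)
  then show False using less not_ordLess_ordLeq by blast
qed

end
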